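(* Let $a,b,c,d\in\mathbb{R}$ satisfy $a>d$, $b>c$ and $a-d\ge b-c$, and put $\Delta=a-d$, $\delta=b-c$. For every $\beta\ge 0$, the stationary expected social welfare of the logit dynamics with inverse noise $\beta$ for the $2\times 2$ coordination game with parameters $a,b,c,d$ is $$\mathbf{E}_\pi[W]=2\cdot\frac{a+be^{-(\Delta-\delta)\beta}+(c+d)e^{-\Delta\beta}}{1+e^{-(\Delta-\delta)\beta}+2e^{-\Delta\beta}}.$$ Moreover, if $a\ne b$, then $\mathbf{E}_\pi[W]\ge \mathsf{SW}_N$ for all sufficiently large $\beta$, where $\mathsf{SW}_N=2\min\{a,b\}$ is the social welfare of the worst (pure) Nash equilibrium.
   Context: Coordination game with parameters $a,b,c,d$: two players, each with strategies $0$ and $1$, and payoffs (first player, second player): $(a,a)$ at profile $(0,0)$, $(c,d)$ at $(0,1)$, $(d,c)$ at $(1,0)$, $(b,b)$ at $(1,1)$. Its pure Nash equilibria are $(0,0)$ and $(1,1)$, with social welfare $2a$ and $2b$ respectively. Logit dynamics: for a strategic game with $n$ players, finite strategy sets $S_i$ and utilities $u_i:\prod_j S_j\to\mathbb{R}$, and for $\beta\ge 0$, let $\sigma_i(y\mid\mathbf{x})=e^{\beta u_i(\mathbf{x}_{-i},y)}/\sum_{z\in S_i}e^{\beta u_i(\mathbf{x}_{-i},z)}$, where $(\mathbf{x}_{-i},y)$ is $\mathbf{x}$ with its $i$-th entry replaced by $y$. The logit dynamics with inverse noise $\beta$ is the Markov chain on $\Omega=\prod_j S_j$ which, from profile $\mathbf{x}$,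 selects a player $i$ uniformly at random and replaces $x_i$ by $y\in S_i$ with probability $\sigma_i(y\mid\mathbf{x})$. It is irreducible and aperiodic; $\pi$ denotes its unique stationary distribution. The social welfare is $W(\mathbf{x})=\sum_i u_i(\mathbf{x})$, and $\mathbf{E}_\pi[W]=\sum_{\mathbf{x}}W(\mathbf{x})\pi(\mathbf{x})$. *)

theory Defs
  imports "HOL-Probability.Probability"
begin

section \<open>Finite strategic games\<close>

text \<open>Players are numbered from 0. Profiles are extensional functions, so that each element of
  the product of the strategy sets is represented exactly once.\<close>

record 's game =
  num_players :: nat
  strategies :: "nat \<Rightarrow> 's set"
  utility :: "nat \<Rightarrow> (nat \<Rightarrow> 's) \<Rightarrow> real"

definition profiles :: "'s game \<Rightarrow> (nat \<Rightarrow> 's) set" where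
  "profiles G = PiE {..<num_players G} (strategies G)"

definition social_welfare :: "'s game \<Rightarrow> (nat \<Rightarrow> 's) \<Rightarrow> real" where
  "social_welfare G x = (\<Sum>i<num_players G. utility G i x)"

definition pure_nash :: "'s game \<Rightarrow> (nat \<Rightarrow> 's) \<Rightarrow> bool" where
  "pure_nash G x \<longleftrightarrow> x \<in> profiles G \<and>
     (\<forall>i<num_players G. \<forall>y\<in>strategies G i. utility G i (x(i := y)) \<le> utility G i x)"

definition worst_nash_welfare :: "'s game \<Rightarrow> real" where
  "worst_nash_welfare G = Min (social_welfare G ` {x. pure_nash G x})"


section \<open>Logit dynamics\<close>

definition logit_prob :: "'s game \<Rightarrow> real \<Rightarrow> nat \<Rightarrow> (nat \<Rightarrow> 's) \<Rightarrow> 's \<Rightarrow> real" where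
  "logit_prob G \<beta> i x y =
     exp (\<beta> * utility G i (x(i := y))) / (\<Sum>z\<in>strategies G i. exp (\<beta> * utility G i (x(i := z))))"

text \<open>The argument of \<^const>\<open>embed_pmf\<close> is a probability mass function whenever the strategy set
  is finite and nonempty; see \<open>pmf_logit_choice\<close> below.\<close>

definition logit_choice :: "'s game \<Rightarrow> real \<Rightarrow> nat \<Rightarrow> (nat \<Rightarrow> 's) \<Rightarrow> 's pmf" where
  "logit_choice G \<beta> i x =
     embed_pmf (\<lambda>y. if y \<in> strategies G i then logit_prob G \<beta> i x y else 0)"

definition logit_step :: "'s game \<Rightarrow> real \<Rightarrow> (nat \<Rightarrow> 's) \<Rightarrow> (nat \<Rightarrow> 's) pmf" where
  "logit_step G \<beta> x =
     bind_pmf (pmf_of_set {..<num_players G}) (\<lambda>i.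
     bind_pmf (logit_choice G \<beta> i x) (\<lambda>y.
     return_pmf (x(i := y))))"

definition stationary :: "'s game \<Rightarrow> real \<Rightarrow> (nat \<Rightarrow> 's) pmf \<Rightarrow> bool" where
  "stationary G \<beta> \<mu> \<longleftrightarrow> set_pmf \<mu> \<subseteq> profiles G \<and> bind_pmf \<mu> (logit_step G \<beta>) = \<mu>"

definition logit_stationary :: "'s game \<Rightarrow> real \<Rightarrow> (nat \<Rightarrow> 's) pmf" where
  "logit_stationary G \<beta> = (THE \<mu>. stationary G \<beta> \<mu>)"

definition expected_welfare :: "'s game \<Rightarrow> real \<Rightarrow> real" where
  "expected_welfare G \<beta> = measure_pmf.expectation (logit_stationary G \<beta>) (social_welfare G)"


section \<open>The coordination game\<close>

definition coordination_payoffs ::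
    "real \<Rightarrow> real \<Rightarrow> real \<Rightarrow> real \<Rightarrow> nat \<Rightarrow> nat \<Rightarrow> real \<times> real" where
  "coordination_payoffs a b c d s t =
     (if s = 0 \<and> t = 0 then (a, a)
      else if s = 0 \<and> t = 1 then (c, d)
      else if s = 1 \<and> t = 0 then (d, c)
      else (b, b))"

definition coordination_game :: "real \<Rightarrow> real \<Rightarrow> real \<Rightarrow> real \<Rightarrow> nat game" where
  "coordination_game a b c d =
     \<lparr> num_players = 2,
       strategies = (\<lambda>_. {0, 1}),
       utility = (\<lambda>i x. (if i = 0 then fst else snd) (coordination_payoffs a b c d (x 0) (x 1))) \<rparr>"


section \<open>Well-definedness\<close>

lemma pmf_logit_choice:
  assumes fin: "finite (strategies G i)" and ne: "strategies G i \<noteq> {}"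
  shows "pmf (logit_choice G \<beta> i x) y = (if y \<in> strategies G i then logit_prob G \<beta> i x y else 0)"
proof -
  let ?S = "strategies G i"
  let ?f = "\<lambda>y. if y \<in> ?S then logit_prob G \<beta> i x y else 0"
  have nn: "0 \<le> ?f y" for y
    by (auto simp: logit_prob_def intro!: divide_nonneg_nonneg sum_nonneg)
  have pos: "(\<Sum>z\<in>?S. exp (\<beta> * utility G i (x(i := z)))) > 0"
    using fin ne by (intro sum_pos) auto
  have "(\<integral>\<^sup>+ y. ennreal (?f y) \<partial>count_space UNIV)
      = (\<Sum>y\<in>?S. ennreal (?f y))"
    using fin by (subst nn_integral_count_space'[of ?S]) auto
  also have "\<dots> = ennreal (\<Sum>y\<in>?S. ?f y)"
    using nn by (intro sum_ennreal)
  also have "(\<Sum>y\<in>?S. ?f y) = 1"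
    using pos by (simp add: logit_prob_def flip: sum_divide_distrib)
  finally have "(\<integral>\<^sup>+ y. ennreal (?f y) \<partial>count_space UNIV) = 1" by simp
  then show ?thesis
    unfolding logit_choice_def by (intro pmf_embed_pmf nn)
qed

lemma pmf_logit_step:
  assumes n: "num_players G > 0"
    and S: "\<And>i. i < num_players G \<Longrightarrow> finite (strategies G i) \<and> strategies G i \<noteq> {}"
  shows "pmf (logit_step G \<beta> x) y =
    (\<Sum>i<num_players G. \<Sum>z\<in>strategies G i.
       if x(i := z) = y then logit_prob G \<beta> i x z else 0) / num_players G"
proof -
  have ch: "pmf (bind_pmf (logit_choice G \<beta> i x) (\<lambda>z. return_pmf (x(i := z)))) y =
      (\<Sum>z\<in>strategies G i. if x(i := z) = y then logit_prob G \<beta> i x z else 0)"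
    if i: "i < num_players G" for i
  proof -
    have "set_pmf (logit_choice G \<beta> i x) \<subseteq> strategies G i"
      using S[OF i] by (auto simp: set_pmf_eq pmf_logit_choice split: if_splits)
    then have "pmf (bind_pmf (logit_choice G \<beta> i x) (\<lambda>z. return_pmf (x(i := z)))) y =
      (\<Sum>z\<in>strategies G i. pmf (return_pmf (x(i := z))) y * pmf (logit_choice G \<beta> i x) z)"
      unfolding pmf_bind using S[OF i] by (intro integral_measure_pmf_real) auto
    also have "\<dots> = (\<Sum>z\<in>strategies G i. if x(i := z) = y then logit_prob G \<beta> i x z else 0)"
      using S[OF i] by (intro sum.cong) (auto simp: pmf_logit_choice indicator_def)
    finally show ?thesis .
  qed
  have ne: "{..<num_players G} \<noteq> {}" using n by auto
  show ?thesis
    unfolding logit_step_def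
    by (subst pmf_bind, subst integral_pmf_of_set[OF ne]) (simp_all add: ch)
qed

lemma ex1_stationary_coordination_game:
  "\<exists>!\<mu>. stationary (coordination_game a b c d) \<beta> \<mu>"
proof -
  let ?G = "coordination_game a b c d"
  define P :: "nat \<Rightarrow> nat \<Rightarrow> nat \<Rightarrow> nat" where "P s t = (\<lambda>_. undefined)(0 := s, 1 := t)" for s t
  have PP: "P s t = P s' t' \<longleftrightarrow> s = s' \<and> t = t'" for s t s' t'
  proof
    assume e: "P s t = P s' t'"
    show "s = s' \<and> t = t'" using fun_cong[OF e, of 0] fun_cong[OF e, of 1] by (simp add: P_def)
  qed simp
  have P0: "P s t 0 = s" "P s t (Suc 0) = t" and U: "(P s t)(0 := z) = P z t" "(P s t)(Suc 0 := z) = P s z"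
    for s t z by (auto simp: P_def)
  have prof: "profiles ?G = {P 0 0, P 0 1, P 1 0, P 1 1}" (is "_ = ?\<Omega>")
  proof
    show "?\<Omega> \<subseteq> profiles ?G"
      by (auto simp: profiles_def coordination_game_def P_def PiE_def extensional_def)
    show "profiles ?G \<subseteq> ?\<Omega>"
    proof
      fix x assume x: "x \<in> profiles ?G"
      have "x = P (x 0) (x 1)"
        using x by (auto simp: profiles_def coordination_game_def P_def PiE_def extensional_def fun_eq_iff)
      moreover have "x 0 \<in> {0,1}" "x 1 \<in> {0,1}"
        using x by (auto simp: profiles_def coordination_game_def PiE_def Pi_def)
      ultimately show "x \<in> ?\<Omega>" by (metis insert_iff empty_iff)
    qed
  qed
  define A where "A = exp (\<beta> * a)"
  define B where "B = exp (\<beta> * b)"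
  define C where "C = exp (\<beta> * c)"
  define D where "D = exp (\<beta> * d)"
  note defs = A_def B_def C_def D_def
  have ABCD: "A > 0" "B > 0" "C > 0" "D > 0" by (simp_all add: defs)
  define s where "s = D / (A + D)"
  define t where "t = B / (B + C)"
  have s: "0 < s" "s < 1" and t: "0 < t" "t < 1"
    using ABCD by (auto simp: s_def t_def field_simps)
  have s': "A / (A + D) = 1 - s" and t': "C / (B + C) = 1 - t"
    using ABCD by (auto simp: s_def t_def field_simps)
  have step: "pmf (logit_step ?G \<beta> x) y =
     (\<Sum>i<2. \<Sum>z\<in>{0,1}. if x(i := z) = y then logit_prob ?G \<beta> i x z else 0) / 2" for x y
    using pmf_logit_step[of ?G \<beta> x y] by (simp add: coordination_game_def)
  have lp: "logit_prob ?G \<beta> 0 (P u 0) 0 = 1 - s" "logit_prob ?G \<beta> 0 (P u 0) (Suc 0) = s"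
     "logit_prob ?G \<beta> 0 (P u (Suc 0)) 0 = 1 - t" "logit_prob ?G \<beta> 0 (P u (Suc 0)) (Suc 0) = t"
     "logit_prob ?G \<beta> (Suc 0) (P 0 u) 0 = 1 - s" "logit_prob ?G \<beta> (Suc 0) (P 0 u) (Suc 0) = s"
     "logit_prob ?G \<beta> (Suc 0) (P (Suc 0) u) 0 = 1 - t" "logit_prob ?G \<beta> (Suc 0) (P (Suc 0) u) (Suc 0) = t"
    for u
    unfolding s'[symmetric] t'[symmetric]
    by (simp_all add: logit_prob_def coordination_game_def U P0 coordination_payoffs_def
          s_def t_def add_ac flip: defs)
  have PPs: "P 0 0 \<noteq> P 0 1" "P 0 0 \<noteq> P 1 0" "P 0 0 \<noteq> P 1 1" "P 0 1 \<noteq> P 1 0" "P 0 1 \<noteq> P 1 1" "P 1 0 \<noteq> P 1 1"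
    by (simp_all add: PP)
  have bind: "pmf (bind_pmf \<mu> (logit_step ?G \<beta>)) y =
      pmf (logit_step ?G \<beta> (P 0 0)) y * pmf \<mu> (P 0 0) + pmf (logit_step ?G \<beta> (P 0 1)) y * pmf \<mu> (P 0 1)
      + pmf (logit_step ?G \<beta> (P 1 0)) y * pmf \<mu> (P 1 0) + pmf (logit_step ?G \<beta> (P 1 1)) y * pmf \<mu> (P 1 1)"
    if "set_pmf \<mu> \<subseteq> ?\<Omega>" for \<mu> y
    unfolding pmf_bind
    by (subst integral_measure_pmf_real[of ?\<Omega>]) (use that PPs in auto)
  have bal: "stationary ?G \<beta> \<mu> \<longleftrightarrow> set_pmf \<mu> \<subseteq> ?\<Omega> \<and>
      pmf \<mu> (P 0 1) = pmf \<mu> (P 1 0) \<and>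
      pmf \<mu> (P 0 0) * s = (1 - s) * pmf \<mu> (P 0 1) \<and>
      pmf \<mu> (P 1 1) * (1 - t) = t * pmf \<mu> (P 0 1)" for \<mu>
  proof (cases "set_pmf \<mu> \<subseteq> ?\<Omega>")
    case True
    let ?q = "bind_pmf \<mu> (logit_step ?G \<beta>)"
    let ?p = "\<lambda>u v. pmf \<mu> (P u v)"
    have e00: "pmf ?q (P 0 0) = (1-s) * ?p 0 0 + (1-s)/2 * (?p 0 1 + ?p 1 0)"
      and e01: "pmf ?q (P 0 1) = s/2 * ?p 0 0 + (1-t)/2 * ?p 1 1 + (s + (1-t))/2 * ?p 0 1"
      and e10: "pmf ?q (P 1 0) = s/2 * ?p 0 0 + (1-t)/2 * ?p 1 1 + (s + (1-t))/2 * ?p 1 0"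
      and e11: "pmf ?q (P 1 1) = t * ?p 1 1 + t/2 * (?p 0 1 + ?p 1 0)"
      unfolding bind[OF True] step
      by (simp_all add: numeral_2_eq_2 lp U PP) (simp_all add: field_simps)
    have out: "pmf ?q y = pmf \<mu> y" if "y \<notin> ?\<Omega>" for y
    proof -
      have "pmf (logit_step ?G \<beta> (P u v)) y = 0" if "u \<in> {0,1}" "v \<in> {0,1}" for u v
        using that \<open>y \<notin> ?\<Omega>\<close> unfolding step by (auto simp: numeral_2_eq_2 U)
      moreover have "pmf \<mu> y = 0" using True that by (auto simp: set_pmf_iff)
      ultimately show ?thesis unfolding bind[OF True] by simp
    qed
    have "?q = \<mu> \<longleftrightarrow> (\<forall>y\<in>?\<Omega>. pmf ?q y = pmf \<mu> y)"
      using out by (metis pmf_eqI)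
    also have "\<dots> \<longleftrightarrow> ?p 0 1 = ?p 1 0 \<and> ?p 0 0 * s = (1 - s) * ?p 0 1 \<and> ?p 1 1 * (1 - t) = t * ?p 0 1"
    proof -
      let ?lhs = "\<forall>y\<in>?\<Omega>. pmf ?q y = pmf \<mu> y"
      have *: "?lhs \<longleftrightarrow> pmf ?q (P 0 0) = ?p 0 0 \<and> pmf ?q (P 0 1) = ?p 0 1 \<and>
          pmf ?q (P 1 0) = ?p 1 0 \<and> pmf ?q (P 1 1) = ?p 1 1" by auto
      show ?thesis
      proof
        assume ?lhs
        then have h: "(1-s) * ?p 0 0 + (1-s)/2 * (?p 0 1 + ?p 1 0) = ?p 0 0"
          "s/2 * ?p 0 0 + (1-t)/2 * ?p 1 1 + (s + (1-t))/2 * ?p 0 1 = ?p 0 1"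
          "s/2 * ?p 0 0 + (1-t)/2 * ?p 1 1 + (s + (1-t))/2 * ?p 1 0 = ?p 1 0"
          "t * ?p 1 1 + t/2 * (?p 0 1 + ?p 1 0) = ?p 1 1"
          unfolding * e00 e01 e10 e11 by blast+
        have "(1 - (s + (1-t))/2) * (?p 0 1 - ?p 1 0) = 0"
          using h(2,3) by (simp add: algebra_simps)
        moreover have "1 - (s + (1-t))/2 \<noteq> 0" using s t by (simp add: field_simps)
        ultimately have e: "?p 0 1 = ?p 1 0" by simp
        show "?p 0 1 = ?p 1 0 \<and> ?p 0 0 * s = (1 - s) * ?p 0 1 \<and> ?p 1 1 * (1 - t) = t * ?p 0 1"
        proof (intro conjI)
          show "?p 0 0 * s = (1 - s) * ?p 0 1" using h(1) e by (simp add: field_simps)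
          show "?p 1 1 * (1 - t) = t * ?p 0 1" using h(4) e by (simp add: field_simps)
        qed (rule e)
      next
        assume h: "?p 0 1 = ?p 1 0 \<and> ?p 0 0 * s = (1 - s) * ?p 0 1 \<and> ?p 1 1 * (1 - t) = t * ?p 0 1"
        then have e: "?p 0 1 = ?p 1 0" and k: "s * ?p 0 0 = ?p 1 0 - s * ?p 1 0"
            "t * ?p 1 1 = ?p 1 1 - t * ?p 1 0"
          by (auto simp: algebra_simps)
        show ?lhs unfolding * e00 e01 e10 e11 e
          using k by (intro conjI) (simp_all add: field_simps)
      qed
    qed
    finally show ?thesis unfolding stationary_def prof using True by simp
  qed (simp add: stationary_def prof)
  define Z where "Z = (1 - s) / s + 2 + t / (1 - t)"
  have Z: "Z > 0" using s t by (simp add: Z_def add_pos_pos)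
  define f where "f = (\<lambda>x. if x = P 0 0 then (1 - s) / s / Z
     else if x = P 0 1 \<or> x = P 1 0 then 1 / Z
     else if x = P 1 1 then t / (1 - t) / Z else 0)"
  have f: "f (P 0 0) = (1 - s) / s / Z" "f (P 0 1) = 1 / Z" "f (P 1 0) = 1 / Z"
    "f (P 1 1) = t / (1 - t) / Z"
    using PPs by (auto simp: f_def)
  have f_nn: "0 \<le> f x" for x using s t Z by (simp add: f_def)
  have f_out: "f x = 0" if "x \<notin> ?\<Omega>" for x using that by (auto simp: f_def)
  have "(\<integral>\<^sup>+ x. ennreal (f x) \<partial>count_space UNIV) = (\<Sum>x\<in>?\<Omega>. ennreal (f x))"
    using f_out by (intro nn_integral_count_space') auto
  also have "\<dots> = ennreal (\<Sum>x\<in>?\<Omega>. f x)" using f_nn by (intro sum_ennreal)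
  also have "(\<Sum>x\<in>?\<Omega>. f x) = f (P 0 0) + f (P 0 1) + f (P 1 0) + f (P 1 1)"
    using PPs by simp
  also have "\<dots> = Z / Z" unfolding f by (subst (5) Z_def) (simp add: add_divide_distrib)
  finally have f_1: "(\<integral>\<^sup>+ x. ennreal (f x) \<partial>count_space UNIV) = 1" using Z by simp
  have pmf_f: "pmf (embed_pmf f) x = f x" for x by (rule pmf_embed_pmf[OF f_nn f_1])
  show ?thesis
  proof (rule ex1I)
    have "set_pmf (embed_pmf f) \<subseteq> ?\<Omega>"
      using f_out unfolding set_pmf_eq pmf_f by blast
    then show "stationary ?G \<beta> (embed_pmf f)"
      unfolding bal pmf_f f using s t Z by (simp add: field_simps)
  next
    fix \<mu> assume "stationary ?G \<beta> \<mu>"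
    then have sub: "set_pmf \<mu> \<subseteq> ?\<Omega>" and m: "pmf \<mu> (P 0 1) = pmf \<mu> (P 1 0)"
      "pmf \<mu> (P 0 0) * s = (1 - s) * pmf \<mu> (P 0 1)"
      "pmf \<mu> (P 1 1) * (1 - t) = t * pmf \<mu> (P 0 1)" unfolding bal by blast+
    let ?r = "pmf \<mu> (P 0 1)"
    have m': "pmf \<mu> (P 0 0) = (1 - s) / s * ?r" "pmf \<mu> (P 1 1) = t / (1 - t) * ?r"
      using m s t by (simp_all add: field_simps)
    have "(\<Sum>x\<in>?\<Omega>. pmf \<mu> x) = 1" using sub by (intro sum_pmf_eq_1) auto
    also have "(\<Sum>x\<in>?\<Omega>. pmf \<mu> x) = pmf \<mu> (P 0 0) + ?r + pmf \<mu> (P 1 0) + pmf \<mu> (P 1 1)"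
      using PPs by simp
    also have "\<dots> = Z * ?r" unfolding m' m(1)[symmetric] by (simp add: Z_def algebra_simps)
    finally have r: "?r = 1 / Z" using Z by (simp add: field_simps)
    show "\<mu> = embed_pmf f"
    proof (rule pmf_eqI)
      fix x
      show "pmf \<mu> x = pmf (embed_pmf f) x"
      proof (cases "x \<in> ?\<Omega>")
        case True
        then show ?thesis using m' m(1)[symmetric] r f unfolding pmf_f by auto
      next
        case False
        then have "pmf \<mu> x = 0" using sub by (auto simp: set_pmf_iff)
        then show ?thesis using f_out[OF False] by (simp add: pmf_f)
      qed
    qed
  qed
qed

end

theory Submission
  imports Defs
begin

text \<open>The coordination game has an exact potential, equal to \<open>a - d\<close> at (0,0), to \<open>b - c\<close> at (1,1)
  and to 0 elsewhere. For an exact potential game the logit dynamics satisfies detailed balance with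
  respect to the Gibbs measure of the potential, which is therefore the stationary distribution;
  the welfare formula is a Gibbs average over four profiles. Times the
  partition function, the excess of the stationary welfare over \<open>2 min {a, b}\<close> equals
  \<open>2 (\<bar>a - b\<bar> exp (\<beta> r) + c + d - 2 min {a, b})\<close>, where \<open>r\<close> is \<open>a - d\<close> or \<open>b - c\<close>
  according to which of \<open>a\<close>, \<open>b\<close> is larger; it tends to infinity with \<open>\<beta>\<close> if \<open>a \<noteq> b\<close>.\<close>

section \<open>Reversible kernels\<close>

text \<open>Detailed balance exchanges the flow into \<open>y\<close> for the flow out of
  \<open>y\<close>, which is \<open>pmf \<mu> y\<close> times the total mass 1 of
  \<open>K y\<close>. Working in \<open>ennreal\<close> avoids any summability argument.\<close>

lemma bind_pmf_eq_if_detailed_balance: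
  assumes "\<And>x y. pmf \<mu> x * pmf (K x) y = pmf \<mu> y * pmf (K y) x"
  shows "bind_pmf \<mu> K = \<mu>"
proof (rule pmf_eqI)
  fix y
  have "ennreal (pmf (bind_pmf \<mu> K) y)
      = (\<integral>\<^sup>+ x. ennreal (pmf \<mu> x) * ennreal (pmf (K x) y) \<partial>count_space UNIV)"
    by (simp add: ennreal_pmf_bind nn_integral_measure_pmf)
  also have "\<dots> = (\<integral>\<^sup>+ x. ennreal (pmf \<mu> y) * ennreal (pmf (K y) x) \<partial>count_space UNIV)"
    by (simp add: assms flip: ennreal_mult)
  also have "\<dots> = ennreal (pmf \<mu> y)"
    by (simp add: nn_integral_cmult nn_integral_pmf_eq_1)
  finally show "pmf (bind_pmf \<mu> K) y = pmf \<mu> y" by simp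
qed


section \<open>Exact potential games\<close>

definition exact_potential :: "'s game \<Rightarrow> ((nat \<Rightarrow> 's) \<Rightarrow> real) \<Rightarrow> bool" where
  "exact_potential G \<Phi> \<longleftrightarrow>
     (\<forall>x\<in>profiles G. \<forall>i<num_players G. \<forall>y\<in>strategies G i.
        utility G i (x(i := y)) - utility G i x = \<Phi> (x(i := y)) - \<Phi> x)"

text \<open>The weights sum to 1 when \<open>profiles G\<close> is finite and nonempty, which is
  what makes \<open>embed_pmf\<close> meaningful. The sign in the exponent favours profiles of high
  potential.\<close>

definition gibbs :: "'s game \<Rightarrow> ((nat \<Rightarrow> 's) \<Rightarrow> real) \<Rightarrow> real \<Rightarrow> (nat \<Rightarrow> 's) pmf" where
  "gibbs G \<Phi> \<beta> = embed_pmf (\<lambda>x.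
     if x \<in> profiles G then exp (\<beta> * \<Phi> x) / (\<Sum>y\<in>profiles G. exp (\<beta> * \<Phi> y)) else 0)"

lemma pmf_gibbs:
  assumes fin: "finite (profiles G)" and ne: "profiles G \<noteq> {}"
  shows "pmf (gibbs G \<Phi> \<beta>) x =
    (if x \<in> profiles G then exp (\<beta> * \<Phi> x) / (\<Sum>y\<in>profiles G. exp (\<beta> * \<Phi> y)) else 0)"
proof -
  let ?f = "\<lambda>x. if x \<in> profiles G then exp (\<beta> * \<Phi> x) / (\<Sum>y\<in>profiles G. exp (\<beta> * \<Phi> y)) else 0"
  have nn: "0 \<le> ?f y" for y
    by (auto intro!: divide_nonneg_nonneg sum_nonneg)
  have pos: "(\<Sum>y\<in>profiles G. exp (\<beta> * \<Phi> y)) > 0"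
    using fin ne by (intro sum_pos) auto
  have "(\<integral>\<^sup>+ y. ennreal (?f y) \<partial>count_space UNIV) = (\<Sum>y\<in>profiles G. ennreal (?f y))"
    using fin by (subst nn_integral_count_space'[of "profiles G"]) auto
  also have "\<dots> = ennreal (\<Sum>y\<in>profiles G. ?f y)"
    using nn by (intro sum_ennreal)
  also have "(\<Sum>y\<in>profiles G. ?f y) = 1"
    using pos by (simp flip: sum_divide_distrib)
  finally have "(\<integral>\<^sup>+ y. ennreal (?f y) \<partial>count_space UNIV) = 1" by simp
  then show ?thesis
    unfolding gibbs_def by (intro pmf_embed_pmf nn)
qed

lemma expectation_gibbs:
  assumes fin: "finite (profiles G)" and ne: "profiles G \<noteq> {}"
  shows "measure_pmf.expectation (gibbs G \<Phi> \<beta>) f =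
    (\<Sum>x\<in>profiles G. f x * exp (\<beta> * \<Phi> x)) / (\<Sum>x\<in>profiles G. exp (\<beta> * \<Phi> x))"
proof -
  have "measure_pmf.expectation (gibbs G \<Phi> \<beta>) f = (\<Sum>x\<in>profiles G. f x * pmf (gibbs G \<Phi> \<beta>) x)"
    using fin ne by (intro integral_measure_pmf_real) (auto simp: set_pmf_iff pmf_gibbs split: if_splits)
  also have "\<dots> = (\<Sum>x\<in>profiles G. f x * exp (\<beta> * \<Phi> x)) / (\<Sum>x\<in>profiles G. exp (\<beta> * \<Phi> x))"
    by (simp add: pmf_gibbs[OF fin ne] sum_divide_distrib)
  finally show ?thesis .
qed

lemma profiles_upd:
  "x \<in> profiles G \<Longrightarrow> i < num_players G \<Longrightarrow> z \<in> strategies G i \<Longrightarrow> x(i := z) \<in> profiles G"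
  by (auto simp: profiles_def PiE_iff extensional_def)

lemma profiles_nth: "x \<in> profiles G \<Longrightarrow> i < num_players G \<Longrightarrow> x i \<in> strategies G i"
  by (auto simp: profiles_def)

text \<open>If two profiles differ only in the entry of player \<open>i\<close>, the logit choices
  between them have the same normalizing sum, and their ratio is the exponential of \<beta> times
  the utility difference. By the exact potential this is the ratio of the Gibbs weights, so detailed
  balance holds.\<close>

lemma stationary_gibbs:
  assumes n: "num_players G > 0"
    and S: "\<And>i. i < num_players G \<Longrightarrow> finite (strategies G i) \<and> strategies G i \<noteq> {}"
    and pot: "exact_potential G \<Phi>"
  shows "stationary G \<beta> (gibbs G \<Phi> \<beta>)"
proof -
  have fin: "finite (profiles G)" and ne: "profiles G \<noteq> {}"
    using S by (auto simp: profiles_def PiE_eq_empty_iff intro!: finite_PiE)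
  note pmf_gibbs = pmf_gibbs[OF fin ne]
  \<comment> \<open>Player \<open>i\<close> can reach \<open>y\<close> only by choosing
    \<open>y i\<close>, so the inner sum has at most one nonzero term.\<close>
  have step: "pmf (logit_step G \<beta> x) y =
      (\<Sum>i<num_players G. if x(i := y i) = y then logit_prob G \<beta> i x (y i) else 0) / num_players G"
    if "y \<in> profiles G" for x y
  proof -
    have "(\<Sum>z\<in>strategies G i. if x(i := z) = y then logit_prob G \<beta> i x z else 0)
        = (if x(i := y i) = y then logit_prob G \<beta> i x (y i) else 0)"
      if i: "i < num_players G" for i
    proof -
      have "(\<Sum>z\<in>strategies G i. if x(i := z) = y then logit_prob G \<beta> i x z else 0)
          = (\<Sum>z\<in>strategies G i. if z = y i then
               (if x(i := y i) = y then logit_prob G \<beta> i x (y i) else 0) else 0)"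
        by (intro sum.cong) auto
      then show ?thesis
        using S[OF i] profiles_nth[OF \<open>y \<in> profiles G\<close> i] by simp
    qed
    then show ?thesis using pmf_logit_step[OF n S] by simp
  qed
  \<comment> \<open>When exactly one of two states is a profile, the Gibbs mass vanishes on one side
    of the balance equation and this transition probability on the other.\<close>
  have step_out: "pmf (logit_step G \<beta> x) y = 0" if "x \<in> profiles G" "y \<notin> profiles G" for x y
    using profiles_upd[OF that(1)] that(2) S
    by (subst pmf_logit_step[OF n]) (auto intro!: sum.neutral)
  have "pmf (gibbs G \<Phi> \<beta>) x * pmf (logit_step G \<beta> x) y
      = pmf (gibbs G \<Phi> \<beta>) y * pmf (logit_step G \<beta> y) x" for x y
  proof (cases "x \<in> profiles G \<and> y \<in> profiles G")
    case True
    then have x: "x \<in> profiles G" and y: "y \<in> profiles G" by auto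
    \<comment> \<open>The balance holds for each player separately; summing over \<open>i\<close>
      then also covers \<open>x = y\<close>, where every player contributes.\<close>
    have "exp (\<beta> * \<Phi> x) * (if x(i := y i) = y then logit_prob G \<beta> i x (y i) else 0)
        = exp (\<beta> * \<Phi> y) * (if y(i := x i) = x then logit_prob G \<beta> i y (x i) else 0)"
      if i: "i < num_players G" for i
    proof (cases "x(i := y i) = y")
      case e: True
      have e': "y(i := x i) = x" by (subst e[symmetric]) simp
      \<comment> \<open>This identifies the two normalizing sums.\<close>
      have same: "y(i := z) = x(i := z)" for z by (subst e[symmetric]) simp
      have "utility G i y - utility G i x = \<Phi> y - \<Phi> x"
        using pot[unfolded exact_potential_def, rule_format, OF x i profiles_nth[OF y i]]
        unfolding e .
      then have "\<Phi> x + utility G i y = \<Phi> y + utility G i x" by simp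
      then have "exp (\<beta> * \<Phi> x) * exp (\<beta> * utility G i y)
          = exp (\<beta> * \<Phi> y) * exp (\<beta> * utility G i x)"
        by (simp flip: exp_add distrib_left)
      then show ?thesis
        unfolding logit_prob_def e e' same by simp
    next
      case False
      then have "y(i := x i) \<noteq> x" by (metis fun_upd_triv fun_upd_upd)
      with False show ?thesis by simp
    qed
    then show ?thesis
      using x y by (simp add: pmf_gibbs step sum_distrib_left)
  qed (auto simp: pmf_gibbs step_out)
  then have "bind_pmf (gibbs G \<Phi> \<beta>) (logit_step G \<beta>) = gibbs G \<Phi> \<beta>"
    by (rule bind_pmf_eq_if_detailed_balance)
  then show ?thesis
    by (auto simp: stationary_def set_pmf_iff pmf_gibbs split: if_splits)
qed


section \<open>The coordination game\<close>

text \<open>The value \<open>undefined\<close> off the two players is the one that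
  \<open>PiE\<close> prescribes, so these are the extensional representatives.\<close>

definition profile2 :: "'s \<Rightarrow> 's \<Rightarrow> nat \<Rightarrow> 's" where
  "profile2 s t = (\<lambda>_. undefined)(0 := s, 1 := t)"

lemma profile2_simps [simp]:
  "profile2 s t 0 = s" "profile2 s t (Suc 0) = t"
  "(profile2 s t)(0 := z) = profile2 z t" "(profile2 s t)(Suc 0 := z) = profile2 s z"
  by (auto simp: profile2_def)

lemma profile2_eq_iff [simp]: "profile2 s t = profile2 s' t' \<longleftrightarrow> s = s' \<and> t = t'"
  by (metis profile2_simps(1,2))

lemma coordination_game_simps [simp]:
  "num_players (coordination_game a b c d) = 2"
  "strategies (coordination_game a b c d) i = {0, 1}"
  "utility (coordination_game a b c d) i x =
     (if i = 0 then fst else snd) (coordination_payoffs a b c d (x 0) (x 1))"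
  by (simp_all add: coordination_game_def)

lemma profiles_coordination_game:
  "profiles (coordination_game a b c d) = {profile2 0 0, profile2 0 1, profile2 1 0, profile2 1 1}"
    (is "_ = ?\<Omega>")
proof
  show "?\<Omega> \<subseteq> profiles (coordination_game a b c d)"
    by (auto simp: profiles_def profile2_def PiE_def extensional_def)
  show "profiles (coordination_game a b c d) \<subseteq> ?\<Omega>"
  proof
    fix x assume x: "x \<in> profiles (coordination_game a b c d)"
    have "x = profile2 (x 0) (x 1)"
      using x by (auto simp: profiles_def profile2_def PiE_def extensional_def fun_eq_iff)
    moreover have "x 0 \<in> {0,1}" "x 1 \<in> {0,1}"
      using x by (auto simp: profiles_def PiE_def Pi_def)
    ultimately show "x \<in> ?\<Omega>" by (metis insert_iff empty_iff)
  qed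
qed

definition coordination_potential :: "real \<Rightarrow> real \<Rightarrow> (nat \<Rightarrow> nat) \<Rightarrow> real" where
  "coordination_potential \<Delta> \<delta> x = (if x 0 \<noteq> x 1 then 0 else if x 0 = 0 then \<Delta> else \<delta>)"

text \<open>A proper unilateral deviation always joins a mixed profile to (0,0) or (1,1). Whichever
  player moves, matching the opponent gains \<open>a - d\<close> in the first case and
  \<open>b - c\<close> in the second.\<close>

lemma exact_potential_coordination_game:
  "exact_potential (coordination_game a b c d) (coordination_potential (a - d) (b - c))"
  by (auto simp: exact_potential_def profiles_coordination_game coordination_potential_def
      coordination_payoffs_def less_2_cases_iff)

text \<open>Each mixed profile has Gibbs weight 1 and welfare \<open>c + d\<close>; together they
  give the summand 2 below and, with the factor 2 pulled out, \<open>c + d\<close> above.\<close>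

lemma expected_welfare_coordination_game:
  "expected_welfare (coordination_game a b c d) \<beta> =
     2 * ((a * exp (\<beta> * (a - d)) + b * exp (\<beta> * (b - c)) + (c + d)) /
          (exp (\<beta> * (a - d)) + exp (\<beta> * (b - c)) + 2))"
proof -
  let ?G = "coordination_game a b c d"
  let ?\<Phi> = "coordination_potential (a - d) (b - c)"
  have "stationary ?G \<beta> (gibbs ?G ?\<Phi> \<beta>)"
    by (intro stationary_gibbs exact_potential_coordination_game) auto
  then have "logit_stationary ?G \<beta> = gibbs ?G ?\<Phi> \<beta>"
    unfolding logit_stationary_def
    by (rule the1_equality[OF ex1_stationary_coordination_game])
  then show ?thesis
    by (simp add: expected_welfare_def expectation_gibbs profiles_coordination_game
        coordination_potential_def social_welfare_def coordination_payoffs_def numeral_2_eq_2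
        algebra_simps add_divide_distrib)
qed

text \<open>At a mixed profile either player gains by matching the other, as \<open>a > d\<close>
  and \<open>b > c\<close>; the same inequalities rule out leaving (0,0) or (1,1).\<close>

lemma pure_nash_coordination_game:
  assumes "a > d" and "b > c"
  shows "{x. pure_nash (coordination_game a b c d) x} = {profile2 0 0, profile2 1 1}"
proof -
  let ?G = "coordination_game a b c d"
  have all2: "(\<forall>i<2. Q i) \<longleftrightarrow> Q 0 \<and> Q 1" for Q :: "nat \<Rightarrow> bool"
    by (auto simp: less_2_cases_iff)
  have iff: "pure_nash ?G x \<longleftrightarrow> x \<in> profiles ?G \<and>
      (\<forall>y\<in>{0, 1}. utility ?G 0 (x(0 := y)) \<le> utility ?G 0 x) \<and>
      (\<forall>y\<in>{0, 1}. utility ?G 1 (x(1 := y)) \<le> utility ?G 1 x)" for x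
    unfolding pure_nash_def coordination_game_simps(1,2) all2 ..
  have "pure_nash ?G (profile2 0 0)" "pure_nash ?G (profile2 1 1)"
    "\<not> pure_nash ?G (profile2 0 1)" "\<not> pure_nash ?G (profile2 1 0)"
    using assms unfolding iff profiles_coordination_game by (simp_all add: coordination_payoffs_def)
  moreover have "x \<in> profiles ?G" if "pure_nash ?G x" for x
    using that by (simp only: pure_nash_def)
  ultimately show ?thesis unfolding profiles_coordination_game by blast
qed

lemma worst_nash_welfare_coordination_game:
  assumes "a > d" and "b > c"
  shows "worst_nash_welfare (coordination_game a b c d) = 2 * min a b"
  unfolding worst_nash_welfare_def pure_nash_coordination_game[OF assms]
  by (simp add: social_welfare_def coordination_payoffs_def numeral_2_eq_2 min_def)

lemma eventually_min_mult_le_weighted_sum: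
  fixes a b c d \<Delta> \<delta> :: real
  assumes "\<Delta> > 0" and "\<delta> > 0" and "a \<noteq> b"
  shows "\<forall>\<^sub>F \<beta> in at_top. min a b * (exp (\<beta> * \<Delta>) + exp (\<beta> * \<delta>) + 2)
           \<le> a * exp (\<beta> * \<Delta>) + b * exp (\<beta> * \<delta>) + (c + d)"
proof -
  \<comment> \<open>Here \<open>r\<close> is the rate of the exponential that survives once the
    terms of the smaller payoff cancel: \<delta> if \<open>a < b\<close>, \<Delta> if
    \<open>b < a\<close>.\<close>
  have ev: "\<forall>\<^sub>F \<beta> in at_top. 2 * min a b - (c + d) \<le> \<bar>a - b\<bar> * exp (\<beta> * r)" if "r > 0" for r :: real
  proof -
    have "filterlim (\<lambda>\<beta>. \<bar>a - b\<bar> * exp (\<beta> * r)) at_top at_top"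
      using assms(3) that
      by (intro filterlim_tendsto_pos_mult_at_top[OF tendsto_const] filterlim_compose[OF exp_at_top]
          filterlim_at_top_mult_tendsto_pos[OF tendsto_const] filterlim_ident) auto
    then show ?thesis by (auto simp: filterlim_at_top)
  qed
  show ?thesis
  proof (cases "a < b")
    case True
    show ?thesis
      using ev[OF assms(2)] by eventually_elim (use True in \<open>simp add: min_def algebra_simps\<close>)
  next
    case False
    with assms(3) have "b < a" by simp
    show ?thesis
      using ev[OF assms(1)] by eventually_elim (use \<open>b < a\<close> in \<open>simp add: min_def algebra_simps\<close>)
  qed
qed

theorem theorem8:
  fixes a b c d \<Delta> \<delta> :: real
  assumes "a > d" and "b > c" and "a - d \<ge> b - c"
    and "\<Delta> = a - d" and "\<delta> = b - c"
  shows "(\<forall>\<beta>\<ge>0. expected_welfare (coordination_game a b c d) \<beta> =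
            2 * ((a + b * exp (- (\<Delta> - \<delta>) * \<beta>) + (c + d) * exp (- \<Delta> * \<beta>)) /
                 (1 + exp (- (\<Delta> - \<delta>) * \<beta>) + 2 * exp (- \<Delta> * \<beta>)))) \<and>
         worst_nash_welfare (coordination_game a b c d) = 2 * min a b \<and>
         (a \<noteq> b \<longrightarrow> (\<forall>\<^sub>F \<beta> in at_top.
            expected_welfare (coordination_game a b c d) \<beta>
              \<ge> worst_nash_welfare (coordination_game a b c d)))"
proof (intro conjI allI impI)
  fix \<beta> :: real
  let ?E = "exp (\<beta> * \<Delta>)"
  let ?num = "a + b * exp (- (\<Delta> - \<delta>) * \<beta>) + (c + d) * exp (- \<Delta> * \<beta>)"
  let ?den = "1 + exp (- (\<Delta> - \<delta>) * \<beta>) + 2 * exp (- \<Delta> * \<beta>)"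
  \<comment> \<open>Expanding the stated fraction by \<open>?E\<close> turns its weights, normalized
    to 1 at (0,0), back into Gibbs weights.\<close>
  have E1: "?E * exp (- (\<Delta> - \<delta>) * \<beta>) = exp (\<beta> * \<delta>)" and E2: "?E * exp (- \<Delta> * \<beta>) = 1"
    by (simp_all add: algebra_simps flip: exp_add)
  \<comment> \<open>The products are grouped so that \<open>E1\<close> and \<open>E2\<close> can
    rewrite them.\<close>
  have "?E * ?num = a * ?E + b * (?E * exp (- (\<Delta> - \<delta>) * \<beta>)) + (c + d) * (?E * exp (- \<Delta> * \<beta>))"
    and "?E * ?den = ?E + ?E * exp (- (\<Delta> - \<delta>) * \<beta>) + 2 * (?E * exp (- \<Delta> * \<beta>))"
    by (simp_all only: algebra_simps)
  then have "expected_welfare (coordination_game a b c d) \<beta> = 2 * ((?E * ?num) / (?E * ?den))"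
    unfolding E1 E2 by (simp add: expected_welfare_coordination_game assms(4,5))
  then show "expected_welfare (coordination_game a b c d) \<beta> = 2 * (?num / ?den)"
    by (subst (asm) mult_divide_mult_cancel_left) auto
next
  show worst: "worst_nash_welfare (coordination_game a b c d) = 2 * min a b"
    using assms(1,2) by (rule worst_nash_welfare_coordination_game)
  assume "a \<noteq> b"
  with assms(1,2) have "\<forall>\<^sub>F \<beta> in at_top.
      min a b * (exp (\<beta> * (a - d)) + exp (\<beta> * (b - c)) + 2)
        \<le> a * exp (\<beta> * (a - d)) + b * exp (\<beta> * (b - c)) + (c + d)"
    by (intro eventually_min_mult_le_weighted_sum) auto
  then show "\<forall>\<^sub>F \<beta> in at_top. expected_welfare (coordination_game a b c d) \<beta>
      \<ge> worst_nash_welfare (coordination_game a b c d)"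
  proof eventually_elim
    case (elim \<beta>)
    \<comment> \<open>Positivity of the partition function allows passing from the inequality
      without division to the quotient.\<close>
    have "0 < exp (\<beta> * (a - d)) + exp (\<beta> * (b - c)) + 2"
      by (intro add_pos_pos) auto
    with elim show ?case
      unfolding worst expected_welfare_coordination_game by (simp add: pos_le_divide_eq)
  qed
qed

end
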